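(* Let $S\subset\mathbb{R}^n$ be closed and convex, let $\phi:\mathbb{R}^n\times\mathbb{R}^n\to\mathbb{R}$ satisfy $\phi(x,x)=0$ for all $x\in S$, assume $\phi(x,\cdot)$ is continuously differentiable on $\mathbb{R}^n$ for every $x\in S$, and let $\bar S=\{x\in S\mid \phi(x,y)\ge 0\ \forall y\in S\}$ be nonempty and closed. Let $\{x^k\}\subset S$ satisfy $$\lim_{k\to\infty}\bigl\|\nabla_y\phi(x^k,x^k)-\nabla_y\phi(P_{\bar S}(x^k),P_{\bar S}(x^k))\bigr\|=0.$$ If $\bar S$ is weakly sharp, then $\bar S$ is augmented weakly sharp with respect to $\{x^k\}$.
   Context: For $x\in S$, $\nabla_y\phi(x,x)$ is the gradient of the function $\phi(x,\cdot)$ at the point $x$, and $\partial_y\phi(x,x)=\{\nabla_y\phi(x,x)\}$. For $C\subset\mathbb{R}^n$ and $x\in C$: the tangent cone $T_C(x)$ is the set of $d$ for which there are $x^j\in C$, $x^j\to x$, $\tau^j\downarrow0$ with $(x^j-x)/\tau^j\to d$; the regular normal cone is $\hat N_C(x)=\{d\mid\langle d,y-x\rangle\le o(\|y-x\|),\ y\in C\}$. For a set $D$, $D^\circ=\{y\mid\langle y,d\rangle\le0\ \forall d\in D\}$. $B$ is the closed unit ball. $P_C(x)$ is the projection, i.e. a point of $\arg\min_{y\in C}\|y-x\|$; if the nearest point is not unique, $P_C(x)$ denotes one nearest point, chosen once and for all. Weak sharpness: $\bar S$ is weakly sharp if there is a constant $\alpha>0$ with $\alpha B\subset\nabla_y\phi(x,x)+[T_S(x)\cap\hat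 N_{\bar S}(x)]^\circ$ for all $x\in\bar S$. Augmented weak sharpness: $\bar S$ is augmented weakly sharp with respect to $\{x^k\}\subset S$ if, whenever $K=\{k\mid x^k\notin\bar S\}$ is infinite, there exists a set-valued mapping $H:\bar S\to2^{\mathbb{R}^n}$ such that (a) there is a constant $\alpha>0$ with $\alpha B\subset H(z)+[T_S(z)\cap\hat N_{\bar S}(z)]^\circ$ for all $z\in\bar S$; (b) for all choices $v^k\in H(P_{\bar S}(x^k))$ ($k\in K$), with $u^k=\nabla_y\phi(x^k,x^k)$, $$\limsup_{k\in K,\,k\to\infty}\frac{1}{\|x^k-P_{\bar S}(x^k)\|}\langle u^k-v^k,\,x^k-P_{\bar S}(x^k)\rangle\ge0.$$ (If $K$ is finite the condition holds vacuously.) *)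

theory Defs
  imports
    "HOL-Analysis.Analysis"
    "HOL-Library.Landau_Symbols"
    "HOL-Library.Set_Algebras"
begin

text \<open>The value of \<open>grad f x\<close> is meaningful only where \<open>f\<close> is differentiable.\<close>

definition grad :: "('a::real_inner \<Rightarrow> real) \<Rightarrow> 'a \<Rightarrow> 'a" where
  "grad f x = (THE D. GDERIV f x :> D)"

definition continuously_differentiable :: "('a::real_inner \<Rightarrow> real) \<Rightarrow> bool" where
  "continuously_differentiable f \<longleftrightarrow>
     (\<forall>y. \<exists>D. GDERIV f y :> D) \<and> continuous_on UNIV (grad f)"

text \<open>\<open>\<tau> \<down> 0\<close> is read, as usual in variational analysis, as convergence to \<open>0\<close>
  through positive values; monotonicity is not required.\<close>

definition tangent_cone :: "'a::real_normed_vector set \<Rightarrow> 'a \<Rightarrow> 'a set" where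
  "tangent_cone C x = {d. \<exists>(xs :: nat \<Rightarrow> 'a) (\<tau> :: nat \<Rightarrow> real).
     (\<forall>j. xs j \<in> C) \<and> xs \<longlonglongrightarrow> x \<and> (\<forall>j. \<tau> j > 0) \<and> \<tau> \<longlonglongrightarrow> 0 \<and>
     (\<lambda>j. (xs j - x) /\<^sub>R \<tau> j) \<longlonglongrightarrow> d}"

definition regular_normal_cone :: "'a::real_inner set \<Rightarrow> 'a \<Rightarrow> 'a set" where
  "regular_normal_cone C x = {d. \<exists>r :: 'a \<Rightarrow> real.
     r \<in> o[at x within C](\<lambda>y. norm (y - x)) \<and> (\<forall>y\<in>C. d \<bullet> (y - x) \<le> r y)}"

definition polar_cone :: "'a::real_inner set \<Rightarrow> 'a set" where
  "polar_cone D = {y. \<forall>d\<in>D. y \<bullet> d \<le> 0}"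

text \<open>\<open>P\<close> selects one nearest point of \<open>C\<close> for every point of the space. All notions below take the
  selection as a parameter, so nothing depends on which nearest point is chosen.\<close>

definition projection_selection :: "'a::real_normed_vector set \<Rightarrow> ('a \<Rightarrow> 'a) \<Rightarrow> bool" where
  "projection_selection C P \<longleftrightarrow>
     (\<forall>x. is_arg_min (\<lambda>y. norm (y - x)) (\<lambda>y. y \<in> C) (P x))"

definition equilibrium_set :: "'a set \<Rightarrow> ('a \<Rightarrow> 'a \<Rightarrow> real) \<Rightarrow> 'a set" where
  "equilibrium_set S \<phi> = {x \<in> S. \<forall>y\<in>S. \<phi> x y \<ge> 0}"

text \<open>Below, \<open>+\<close> on sets is the Minkowski sum, \<open>cball 0 \<alpha>\<close> is \<open>\<alpha> B\<close>, and \<open>grad (\<phi> x) x\<close>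
  is the gradient of \<open>\<phi>(x, \<cdot>)\<close> at the point \<open>x\<close>.\<close>

definition weakly_sharp :: "'a::euclidean_space set \<Rightarrow> ('a \<Rightarrow> 'a \<Rightarrow> real) \<Rightarrow> 'a set \<Rightarrow> bool" where
  "weakly_sharp S \<phi> Sb \<longleftrightarrow>
     (\<exists>\<alpha>>0. \<forall>x\<in>Sb. cball 0 \<alpha> \<subseteq>
        {grad (\<phi> x) x} + polar_cone (tangent_cone S x \<inter> regular_normal_cone Sb x))"

text \<open>The limit superior along \<open>K\<close> is taken over the filter \<open>sequentially \<sqinter> principal K\<close>,
  in the extended reals since the quotients need not be bounded.\<close>

definition augmented_weakly_sharp ::
  "'a::euclidean_space set \<Rightarrow> ('a \<Rightarrow> 'a \<Rightarrow> real) \<Rightarrow> 'a set \<Rightarrow> ('a \<Rightarrow> 'a) \<Rightarrow> (nat \<Rightarrow> 'a) \<Rightarrow> bool" where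
  "augmented_weakly_sharp S \<phi> Sb P x \<longleftrightarrow>
     (let K = {k. x k \<notin> Sb} in
      infinite K \<longrightarrow>
      (\<exists>H :: 'a \<Rightarrow> 'a set.
         (\<exists>\<alpha>>0. \<forall>z\<in>Sb. cball 0 \<alpha> \<subseteq>
            H z + polar_cone (tangent_cone S z \<inter> regular_normal_cone Sb z)) \<and>
         (\<forall>v. (\<forall>k\<in>K. v k \<in> H (P (x k))) \<longrightarrow>
            Limsup (inf sequentially (principal K))
              (\<lambda>k. ereal (1 / norm (x k - P (x k)) *
                 ((grad (\<phi> (x k)) (x k) - v k) \<bullet> (x k - P (x k))))) \<ge> 0)))"

end

theory Submission
  imports Defs
begin

text \<open>An infinite set of indices meets every tail of the naturals. Nontriviality matters
  because \<open>Limsup\<close> along the trivial filter is minus infinity in the extended reals,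
  which would violate the bound in (b).\<close>

lemma inf_sequentially_principal_neq_bot:
  assumes "infinite K"
  shows "inf sequentially (principal K) \<noteq> bot"
  using assms
  by (auto simp: trivial_limit_def eventually_inf_principal eventually_sequentially
      infinite_nat_iff_unbounded_le)

text \<open>This is Cauchy--Schwarz divided by \<open>norm d\<close>. The case \<open>d = 0\<close>
  is covered too, since \<open>1 / 0 = 0\<close> makes the left side vanish.\<close>

lemma abs_inner_divide_norm_le:
  fixes w d :: "'a::real_inner"
  shows "\<bar>1 / norm d * (w \<bullet> d)\<bar> \<le> norm w"
  using Cauchy_Schwarz_ineq2[of w d] by (cases "d = 0") (simp_all add: abs_mult field_simps)

text \<open>With \<open>H z\<close> the singleton of the gradient at \<open>z\<close>, condition (a) is weak sharpness itself, and
  by Cauchy--Schwarz the quotients in (b) tend to \<open>0\<close> together with the gradient differences.\<close>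

theorem proposition3p4:
  fixes S :: "(real ^ 'n) set"
    and \<phi> :: "real ^ 'n \<Rightarrow> real ^ 'n \<Rightarrow> real"
    and Sb :: "(real ^ 'n) set"
    and P :: "real ^ 'n \<Rightarrow> real ^ 'n"
    and x :: "nat \<Rightarrow> real ^ 'n"
  assumes "closed S" and "convex S"
    and "\<And>z. z \<in> S \<Longrightarrow> \<phi> z z = 0"
    and "\<And>z. z \<in> S \<Longrightarrow> continuously_differentiable (\<phi> z)"
    and "Sb = equilibrium_set S \<phi>"
    and "Sb \<noteq> {}" and "closed Sb"
    and "projection_selection Sb P"
    and "\<And>k. x k \<in> S"
    and "(\<lambda>k. norm (grad (\<phi> (x k)) (x k) - grad (\<phi> (P (x k))) (P (x k)))) \<longlonglongrightarrow> 0"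
    and "weakly_sharp S \<phi> Sb"
  shows "augmented_weakly_sharp S \<phi> Sb P x"
proof -
  define H where "H = (\<lambda>z. {grad (\<phi> z) z})"
  have sharp: "\<exists>\<alpha>>0. \<forall>z\<in>Sb. cball 0 \<alpha> \<subseteq>
      H z + polar_cone (tangent_cone S z \<inter> regular_normal_cone Sb z)"
    using assms(11) by (simp add: weakly_sharp_def H_def)
  have limsup: "Limsup (inf sequentially (principal K))
      (\<lambda>k. ereal (1 / norm (x k - P (x k)) *
        ((grad (\<phi> (x k)) (x k) - v k) \<bullet> (x k - P (x k))))) \<ge> 0"
    (is "Limsup ?F (\<lambda>k. ereal (?q k)) \<ge> 0")
    if K: "infinite K" and v: "\<forall>k\<in>K. v k \<in> H (P (x k))" for K v
  proof -
    have bound: "eventually (\<lambda>k. norm (?q k) \<le>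
        norm (grad (\<phi> (x k)) (x k) - grad (\<phi> (P (x k))) (P (x k)))) ?F"
      unfolding eventually_inf_principal real_norm_def
    proof (intro always_eventually allI impI)
      fix k assume "k \<in> K"
      with v have "v k = grad (\<phi> (P (x k))) (P (x k))"
        by (simp add: H_def)
      then show "\<bar>?q k\<bar> \<le> norm (grad (\<phi> (x k)) (x k) - grad (\<phi> (P (x k))) (P (x k)))"
        using abs_inner_divide_norm_le by metis
    qed
    \<comment> \<open>The gradient differences tend to 0 along \<open>sequentially\<close>, hence
      also along the finer filter \<open>?F\<close> that only sees indices in \<open>K\<close>; the
      quotients are squeezed by them.\<close>
    have "(?q \<longlongrightarrow> 0) ?F"
      using bound tendsto_mono[OF inf_le1 assms(10)] by (rule Lim_null_comparison)
    then have "((\<lambda>k. ereal (?q k)) \<longlongrightarrow> 0) ?F"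
      unfolding zero_ereal_def by (rule tendsto_ereal)
    \<comment> \<open>Along a nontrivial filter the limit superior of a convergent family is its
      limit, so here it equals 0.\<close>
    then show ?thesis
      using lim_imp_Limsup[OF inf_sequentially_principal_neq_bot[OF K]] by force
  qed
  show ?thesis
    unfolding augmented_weakly_sharp_def Let_def using sharp limsup by blast
qed

end
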